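(* Let $r>s\ge 2$ and $m\ge 1$ be integers, let $\rho=r/\gcd\{r,s\}$, $\sigma=s/\gcd\{r,s\}$, and $$N_2'=1+s(r-1)\frac{[(r-1)(s-1)]^{m}-1}{(r-1)(s-1)-1}.$$ Suppose that $\rho$ divides $s\frac{[(r-1)(s-1)]^{m}-1}{(r-1)(s-1)-1}-1$. Then no bipartite biregular graph with degrees $r,s$ and diameter $2m+1$ has order equal to $M(r,s;2m+1)=\lfloor N_2'/\rho\rfloor(\rho+\sigma)$. Instead, every such graph $G=(V_1\cup V_2,E)$ (vertices of $V_1$ of degree $r$, of $V_2$ of degree $s$) satisfies $|V_1|\le \left(\frac{N_2'}{\rho}-1\right)\sigma$ and $|V_2|\le\left(\frac{N_2'}{\rho}-1\right)\rho$, so its order is at most $$M^*(r,s;2m+1)=\left(\frac{N_2'}{\rho}-1\right)(\rho+\sigma).$$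
   Context: A bipartite graph with stable sets $V_1,V_2$ is biregular with degrees $r,s$ if all vertices of $V_1$ have degree $r$ and all vertices of $V_2$ have degree $s$; its order is $|V_1|+|V_2|$. *)

theory Defs
  imports Complex_Main "Graph_Theory.Graph_Theory"
begin

text \<open>
  Finite simple undirected graphs are the locale \<open>graph\<close> (finite, loop-free and symmetric, without
  parallel arcs). Each undirected edge is a pair of opposite arcs, so the degree of a vertex is its
  out-degree.
\<close>

definition bipartite_biregular ::
  "('a, 'b) pre_digraph \<Rightarrow> 'a set \<Rightarrow> 'a set \<Rightarrow> nat \<Rightarrow> nat \<Rightarrow> bool" where
  "bipartite_biregular G V1 V2 r s \<longleftrightarrow>
     graph G \<and>
     verts G = V1 \<union> V2 \<and> V1 \<inter> V2 = {} \<and>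
     (\<forall>u\<in>V1. \<forall>v\<in>V1. \<not> u \<rightarrow>\<^bsub>G\<^esub> v) \<and>
     (\<forall>u\<in>V2. \<forall>v\<in>V2. \<not> u \<rightarrow>\<^bsub>G\<^esub> v) \<and>
     (\<forall>v\<in>V1. out_degree G v = r) \<and>
     (\<forall>v\<in>V2. out_degree G v = s)"

text \<open>The distance is \<open>\<infinity>\<close> between vertices in different components, and so is then the diameter.\<close>

definition graph_dist :: "('a, 'b) pre_digraph \<Rightarrow> 'a \<Rightarrow> 'a \<Rightarrow> ereal" where
  "graph_dist G u v = wf_digraph.\<mu> G (\<lambda>_. 1) u v"

definition graph_diameter :: "('a, 'b) pre_digraph \<Rightarrow> ereal" where
  "graph_diameter G = (SUP (u, v) \<in> verts G \<times> verts G. graph_dist G u v)"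

definition rho :: "nat \<Rightarrow> nat \<Rightarrow> nat" where
  "rho r s = r div gcd r s"

definition sigma :: "nat \<Rightarrow> nat \<Rightarrow> nat" where
  "sigma r s = s div gcd r s"

text \<open>The integer division is exact, see \<open>geom_quot_real\<close> below.\<close>

definition geom_quot :: "nat \<Rightarrow> nat \<Rightarrow> nat \<Rightarrow> int" where
  "geom_quot r s m =
     (((int r - 1) * (int s - 1)) ^ m - 1) div ((int r - 1) * (int s - 1) - 1)"

definition N2' :: "nat \<Rightarrow> nat \<Rightarrow> nat \<Rightarrow> int" where
  "N2' r s m = 1 + int s * (int r - 1) * geom_quot r s m"

definition moore_bound :: "nat \<Rightarrow> nat \<Rightarrow> nat \<Rightarrow> int" where
  "moore_bound r s m =
     \<lfloor>real_of_int (N2' r s m) / real (rho r s)\<rfloor> * (int (rho r s) + int (sigma r s))"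

definition improved_bound :: "nat \<Rightarrow> nat \<Rightarrow> nat \<Rightarrow> real" where
  "improved_bound r s m =
     (real_of_int (N2' r s m) / real (rho r s) - 1) * (real (rho r s) + real (sigma r s))"

lemma geom_quot_real:
  "real_of_int (geom_quot r s m) =
     (((real r - 1) * (real s - 1)) ^ m - 1) / ((real r - 1) * (real s - 1) - 1)"
proof -
  define x where "x = (int r - 1) * (int s - 1)"
  have "x - 1 dvd x ^ m - 1"
    by (metis dvd_triv_left power_diff_1_eq)
  then have "real_of_int ((x ^ m - 1) div (x - 1)) = real_of_int (x ^ m - 1) / real_of_int (x - 1)"
    by (rule real_of_int_div)
  then show ?thesis
    by (simp add: geom_quot_def x_def)
qed

lemma rho_real: "real (rho r s) = real r / real (gcd r s)"
  by (simp add: rho_def real_of_nat_div)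

lemma sigma_real: "real (sigma r s) = real s / real (gcd r s)"
  by (simp add: sigma_def real_of_nat_div)

end

theory Submission
  imports Defs
begin

text \<open>
  Two vertices on the same side are at even distance, hence at distance at most \<open>2m\<close>. Counting
  distance spheres around a vertex of \<open>V2\<close> gives \<open>|V2| \<le> N2'\<close>. If equality holds, then every vertex
  at distance \<open>1, \<dots>, 2m\<close> from a vertex of \<open>V2\<close> has exactly one neighbour closer to it, and
  this property carries over to centres in \<open>V1\<close>. So the spheres around a vertex of \<open>V1\<close> are as large
  as possible too, and \<open>|V1| = 1 + r (s - 1) g\<close> where \<open>g\<close> is the geometric sum. Together with
  \<open>r |V1| = s |V2|\<close> this forces \<open>1 + g ((r - 1) (s - 1) - 1) = 0\<close>, which is absurd. Therefore
  \<open>|V2| < N2'\<close>; as \<open>|V1| = k \<sigma>\<close> and \<open>|V2| = k \<rho>\<close> for some \<open>k\<close>, and the divisibility hypothesis says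
  that \<open>\<rho>\<close> divides \<open>N2'\<close>, it follows that \<open>k \<le> N2' / \<rho> - 1\<close>.
\<close>

section \<open>Distances in a relation and the sphere sizes of a biregular tree\<close>

definition rel_dist :: "('a \<times> 'a) set \<Rightarrow> 'a \<Rightarrow> 'a \<Rightarrow> nat" where
  "rel_dist E u v = (LEAST n. (u, v) \<in> E ^^ n)"

definition parents :: "('a \<times> 'a) set \<Rightarrow> 'a \<Rightarrow> 'a \<Rightarrow> 'a set" where
  "parents E u w = {v. (v, w) \<in> E \<and> rel_dist E u w = Suc (rel_dist E u v)}"

text \<open>These are the level sizes of the infinite tree whose levels alternate between degrees
  \<open>a\<close> and \<open>b\<close>, with a root of degree \<open>a\<close>. Level
  \<open>Suc d\<close> with \<open>d\<close> even has degree \<open>b\<close>, and one edge of each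
  vertex leads back to the root.\<close>

fun sphere_bound :: "nat \<Rightarrow> nat \<Rightarrow> nat \<Rightarrow> nat" where
  "sphere_bound a b 0 = 1"
| "sphere_bound a b (Suc 0) = a"
| "sphere_bound a b (Suc (Suc d)) =
     (if even d then b - 1 else a - 1) * sphere_bound a b (Suc d)"

lemma sphere_bound_odd_even:
  "sphere_bound a b (Suc (2 * i)) = a * ((a - 1) * (b - 1)) ^ i"
  "sphere_bound a b (Suc (Suc (2 * i))) = a * (b - 1) * ((a - 1) * (b - 1)) ^ i"
  by (induction i) (simp_all add: ac_simps)

text \<open>Even levels form the root's own class; for \<open>a = s\<close> and \<open>b = r\<close>
  the right-hand side is \<open>N2'\<close> with the geometric quotient written as a sum.\<close>

lemma sum_even_sphere_bound:
  "(\<Sum>i\<le>m. sphere_bound a b (2 * i)) = 1 + a * (b - 1) * (\<Sum>i<m. ((a - 1) * (b - 1)) ^ i)"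
  by (induction m) (simp_all add: sphere_bound_odd_even distrib_left del: sphere_bound.simps(3))

lemma relpow_sym:
  assumes "sym E" "(u, v) \<in> E ^^ n"
  shows "(v, u) \<in> E ^^ n"
  using assms(2)
proof (induction n arbitrary: v)
  case 0
  then show ?case by simp
next
  case (Suc n)
  then obtain w where "(u, w) \<in> E ^^ n" "(w, v) \<in> E" by auto
  then show ?case using Suc.IH assms(1) by (meson relpow_Suc_I2 symD)
qed

lemma rel_dist_sym: "sym E \<Longrightarrow> rel_dist E u v = rel_dist E v u"
  unfolding rel_dist_def by (metis relpow_sym)

lemma rel_dist_le: "(u, v) \<in> E ^^ n \<Longrightarrow> rel_dist E u v \<le> n"
  unfolding rel_dist_def by (rule Least_le)

text \<open>Reachability makes the \<open>LEAST\<close> in \<open>rel_dist\<close> meaningful; for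
  unreachable pairs its value is unspecified.\<close>

lemma relpow_rel_dist: "(u, v) \<in> E\<^sup>* \<Longrightarrow> (u, v) \<in> E ^^ rel_dist E u v"
  unfolding rel_dist_def by (metis LeastI rtrancl_imp_relpow)

section \<open>Distance and parity in connected biregular bipartite graphs\<close>

locale biregular_bipartite =
  fixes E :: "('a \<times> 'a) set" and A B :: "'a set" and a b :: nat
  assumes finite_A: "finite A" and finite_B: "finite B"
    and disjoint: "A \<inter> B = {}"
    and edges: "E \<subseteq> A \<times> B \<union> B \<times> A"
    and sym_E: "sym E"
    and degree_A: "v \<in> A \<Longrightarrow> card (E `` {v}) = a"
    and degree_B: "v \<in> B \<Longrightarrow> card (E `` {v}) = b"
    and connected: "\<lbrakk>u \<in> A \<union> B; v \<in> A \<union> B\<rbrakk> \<Longrightarrow> (u, v) \<in> E\<^sup>*"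
begin

abbreviation D where "D \<equiv> rel_dist E"

abbreviation sphere where "sphere u d \<equiv> {w \<in> A \<union> B. D u w = d}"

text \<open>Spheres are counted around centres in \<open>A\<close> only; this symmetry transfers the
  results to centres in \<open>B\<close>.\<close>

lemma swap: "biregular_bipartite E B A b a"
  using finite_A finite_B disjoint edges sym_E degree_A degree_B connected
  by unfold_locales auto

lemma edge_in: "(v, w) \<in> E \<Longrightarrow> v \<in> A \<union> B \<and> w \<in> A \<union> B"
  using edges by auto

lemma edge_sym: "(v, w) \<in> E \<Longrightarrow> (w, v) \<in> E"
  using sym_E by (rule symD)

lemma D_sym: "D u v = D v u"
  using sym_E by (rule rel_dist_sym)

lemma relpow_D: "\<lbrakk>u \<in> A \<union> B; v \<in> A \<union> B\<rbrakk> \<Longrightarrow> (u, v) \<in> E ^^ D u v"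
  using connected by (rule relpow_rel_dist)

lemma D_self: "D u u = 0"
  using rel_dist_le[of u u 0 E] by simp

lemma D_eq_0: "\<lbrakk>u \<in> A \<union> B; v \<in> A \<union> B\<rbrakk> \<Longrightarrow> D u v = 0 \<longleftrightarrow> u = v"
  using relpow_D[of u v] D_self by auto

lemma D_edge_le:
  assumes "u \<in> A \<union> B" "(v, w) \<in> E"
  shows "D u w \<le> Suc (D u v)"
  using relpow_D[of u v] assms edge_in by (blast intro: rel_dist_le relpow_Suc_I)

lemma parent_exists:
  assumes "u \<in> A \<union> B" "w \<in> A \<union> B" "D u w = Suc k"
  obtains v where "(v, w) \<in> E" "D u v = k"
proof -
  have "(u, w) \<in> E ^^ Suc k"
    using relpow_D[OF assms(1,2)] assms(3) by simp
  then obtain v where v: "(u, v) \<in> E ^^ k" "(v, w) \<in> E" by auto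
  then have "D u v \<le> k" by (auto intro: rel_dist_le)
  with D_edge_le[OF assms(1) v(2)] assms(3) v(2) show thesis
    by (intro that) auto
qed

lemma relpow_parity:
  assumes "u \<in> A \<union> B" "(u, v) \<in> E ^^ n"
  shows "v \<in> A \<union> B \<and> (even n \<longleftrightarrow> (u \<in> A \<longleftrightarrow> v \<in> A))"
  using assms(2)
proof (induction n arbitrary: v)
  case 0
  then show ?case using assms by simp
next
  case (Suc n)
  then obtain w where w: "(u, w) \<in> E ^^ n" "(w, v) \<in> E" by auto
  show ?case using Suc.IH[OF w(1)] w(2) edges disjoint by auto
qed

lemma D_parity:
  "\<lbrakk>u \<in> A \<union> B; v \<in> A \<union> B\<rbrakk> \<Longrightarrow> even (D u v) \<longleftrightarrow> (u \<in> A \<longleftrightarrow> v \<in> A)"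
  using relpow_D relpow_parity by blast

text \<open>The ends of an edge lie in different classes, so their distances from \<open>u\<close>
  differ in parity, while they differ by at most one.\<close>

lemma D_edge:
  assumes "u \<in> A \<union> B" "(v, w) \<in> E"
  shows "D u v = Suc (D u w) \<or> D u w = Suc (D u v)"
proof -
  have "even (D u v) \<noteq> even (D u w)"
    using D_parity[OF assms(1)] edge_in[OF assms(2)] assms(2) edges disjoint by blast
  moreover have "D u w \<le> Suc (D u v)" "D u v \<le> Suc (D u w)"
    using D_edge_le assms edge_sym by auto
  ultimately show ?thesis by presburger
qed

section \<open>Counting spheres by the edges that enter them\<close>

lemma finite_neighbours: "finite (E `` {v})"
  using finite_subset[OF edges] finite_A finite_B by (auto intro: finite_Image)

lemma parents_subset: "parents E u w \<subseteq> E `` {w}"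
  using edge_sym by (auto simp: parents_def)

lemma finite_parents: "finite (parents E u w)"
  using parents_subset finite_neighbours by (rule finite_subset)

lemma finite_sphere: "finite (sphere u d)"
  using finite_A finite_B by auto

lemma card_parents_ge_1:
  assumes "u \<in> A \<union> B" "w \<in> sphere u (Suc d)"
  shows "1 \<le> card (parents E u w)"
proof -
  obtain v where "(v, w) \<in> E" "D u v = d"
    using parent_exists assms by blast
  then have "v \<in> parents E u w"
    using assms by (simp add: parents_def)
  then show ?thesis
    using finite_parents[of u w] by (metis One_nat_def Suc_leI card_gt_0_iff empty_iff)
qed

text \<open>Both sides count the edges between consecutive spheres: by \<open>D_edge\<close>, a
  neighbour of \<open>v\<close> that is not a parent lies on the next sphere.\<close>

lemma sum_card_parents:
  assumes "u \<in> A \<union> B"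
  shows "(\<Sum>w\<in>sphere u (Suc d). card (parents E u w)) =
    (\<Sum>v\<in>sphere u d. card (E `` {v}) - card (parents E u v))"
proof -
  have eq: "card (E `` {v}) - card (parents E u v) = card {w \<in> sphere u (Suc d). (v, w) \<in> E}"
    if "v \<in> sphere u d" for v
  proof -
    have "{w \<in> sphere u (Suc d). (v, w) \<in> E} = E `` {v} - parents E u v"
    proof (intro equalityI subsetI)
      fix w assume "w \<in> {w \<in> sphere u (Suc d). (v, w) \<in> E}"
      then show "w \<in> E `` {v} - parents E u v"
        using that by (simp add: parents_def)
    next
      fix w assume "w \<in> E `` {v} - parents E u v"
      then have "(v, w) \<in> E" "D u v \<noteq> Suc (D u w)"
        using edge_sym by (auto simp: parents_def)
      then show "w \<in> {w \<in> sphere u (Suc d). (v, w) \<in> E}"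
        using that D_edge[OF assms] edge_in by blast
    qed
    then show ?thesis
      using card_Diff_subset[OF finite_parents parents_subset] by simp
  qed
  have "{v \<in> sphere u d. (v, w) \<in> E} = parents E u w"
    if "w \<in> sphere u (Suc d)" for w
    using that edge_in by (auto simp: parents_def)
  then have "(\<Sum>v\<in>sphere u d. card {w \<in> sphere u (Suc d). (v, w) \<in> E}) =
      (\<Sum>w\<in>sphere u (Suc d). card (parents E u w))"
    by (intro sum_multicount_gen finite_sphere) simp
  then show ?thesis
    using sum.cong[OF refl eq, of "sphere u d"] by simp
qed

lemma sphere_0: "u \<in> A \<union> B \<Longrightarrow> sphere u 0 = {u}"
  using D_eq_0 D_self by auto

lemma parents_self: "parents E u u = {}"
  by (simp add: parents_def D_self)

lemma sum_card_parents_1: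
  assumes "u \<in> A"
  shows "(\<Sum>w\<in>sphere u (Suc 0). card (parents E u w)) = a"
  using sum_card_parents[of u 0] sphere_0[of u] assms degree_A by (simp add: parents_self)

lemma degree_sphere:
  assumes "u \<in> A" "v \<in> sphere u d"
  shows "card (E `` {v}) = (if even d then a else b)"
  using assms degree_A degree_B D_parity[of u v] by auto

lemma sum_card_parents_le:
  assumes "u \<in> A"
  shows "(\<Sum>w\<in>sphere u (Suc (Suc d)). card (parents E u w)) \<le>
    (if even d then b - 1 else a - 1) * card (sphere u (Suc d))"
proof -
  have "card (E `` {v}) - card (parents E u v) \<le> (if even d then b - 1 else a - 1)"
    if "v \<in> sphere u (Suc d)" for v
    using degree_sphere[OF assms that] card_parents_ge_1[of u v d] that assms by auto
  then show ?thesis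
    using sum_card_parents[of u "Suc d"] assms
      sum_bounded_above[of "sphere u (Suc d)" "\<lambda>v. card (E `` {v}) - card (parents E u v)"]
    by (simp add: mult.commute)
qed

lemma card_sphere_le_sum_parents:
  assumes "u \<in> A"
  shows "card (sphere u (Suc d)) \<le> (\<Sum>w\<in>sphere u (Suc d). card (parents E u w))"
  using sum_mono[of "sphere u (Suc d)" "\<lambda>_. 1" "\<lambda>w. card (parents E u w)"]
    card_parents_ge_1[of u _ d] assms by simp

text \<open>Bounding the entering edges rather than just the vertices makes a second parent cost
  something: \<open>card_sphere_less\<close> turns it into a strict inequality.\<close>

lemma sum_card_parents_le_bound:
  assumes "u \<in> A"
  shows "(\<Sum>w\<in>sphere u (Suc d). card (parents E u w)) \<le> sphere_bound a b (Suc d)"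
proof (induction d)
  case 0
  show ?case using sum_card_parents_1[OF assms] by simp
next
  case (Suc d)
  have "card (sphere u (Suc d)) \<le> sphere_bound a b (Suc d)"
    using card_sphere_le_sum_parents[OF assms, of d] Suc.IH by simp
  then have "(if even d then b - 1 else a - 1) * card (sphere u (Suc d)) \<le>
      sphere_bound a b (Suc (Suc d))"
    unfolding sphere_bound.simps by (rule mult_le_mono2)
  then show ?case
    using sum_card_parents_le[OF assms, of d] by linarith
qed

lemma card_sphere_le:
  assumes "u \<in> A"
  shows "card (sphere u d) \<le> sphere_bound a b d"
proof (cases d)
  case 0
  then show ?thesis using sphere_0[of u] assms by simp
next
  case (Suc k)
  then show ?thesis
    using card_sphere_le_sum_parents[OF assms, of k] sum_card_parents_le_bound[OF assms, of k]
    by simp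
qed

lemma card_sphere_less:
  assumes "u \<in> A" "w \<in> sphere u (Suc d)" "card (parents E u w) \<noteq> 1"
  shows "card (sphere u (Suc d)) < sphere_bound a b (Suc d)"
proof -
  have "(\<Sum>w\<in>sphere u (Suc d). 1) < (\<Sum>w\<in>sphere u (Suc d). card (parents E u w))"
  proof (rule sum_strict_mono_ex1[OF finite_sphere])
    show "\<forall>w\<in>sphere u (Suc d). 1 \<le> card (parents E u w)"
      using card_parents_ge_1[of u _ d] assms(1) by blast
    then show "\<exists>w\<in>sphere u (Suc d). 1 < card (parents E u w)"
      using assms(2,3) by (metis le_neq_implies_less)
  qed
  then show ?thesis
    using sum_card_parents_le_bound[OF assms(1), of d] by simp
qed

text \<open>With one parent per vertex, spheres have as many vertices as entering edges and exactly
  one edge per vertex goes back, so the tree count is attained up to radius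
  \<open>n\<close>.\<close>

lemma card_sphere_eq:
  assumes "u \<in> A"
    and unique: "\<And>w. \<lbrakk>w \<in> A \<union> B; 1 \<le> D u w; D u w \<le> n\<rbrakk> \<Longrightarrow> card (parents E u w) = 1"
    and "d \<le> n"
  shows "card (sphere u d) = sphere_bound a b d"
  using \<open>d \<le> n\<close>
proof (induction d)
  case 0
  show ?case using sphere_0[of u] assms by simp
next
  case (Suc d)
  have "card (sphere u (Suc d)) = (\<Sum>w\<in>sphere u (Suc d). card (parents E u w))"
    using unique Suc.prems by simp
  also have "\<dots> = sphere_bound a b (Suc d)"
  proof (cases d)
    case 0
    then show ?thesis using sum_card_parents_1[OF assms(1)] by simp
  next
    case d: (Suc e)
    have "(\<Sum>w\<in>sphere u (Suc d). card (parents E u w)) =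
        (\<Sum>v\<in>sphere u d. if even e then b - 1 else a - 1)"
      unfolding sum_card_parents[OF UnI1[OF assms(1)]]
    proof (rule sum.cong[OF refl])
      fix v assume v: "v \<in> sphere u d"
      then show "card (E `` {v}) - card (parents E u v) = (if even e then b - 1 else a - 1)"
        using degree_sphere[OF assms(1) v] unique[of v] d Suc.prems by simp
    qed
    also have "\<dots> = (if even e then b - 1 else a - 1) * card (sphere u d)"
      by simp
    finally show ?thesis
      using Suc d by (simp only: sphere_bound.simps)
  qed
  finally show ?case .
qed

section \<open>The size of a class and the extremal case\<close>

lemma card_A_eq_sum_spheres:
  assumes "u \<in> A" and diam: "\<And>v. v \<in> A \<Longrightarrow> D u v \<le> 2 * m + 1"
  shows "card A = (\<Sum>i\<le>m. card (sphere u (2 * i)))"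
proof -
  have "A = (\<Union>i\<le>m. sphere u (2 * i))"
  proof (intro equalityI subsetI)
    fix v assume v: "v \<in> A"
    then have "even (D u v)" using D_parity[of u v] assms(1) by blast
    then obtain i where "D u v = 2 * i" by (rule evenE)
    \<comment> \<open>An even distance of at most \<open>2 * m + 1\<close> is at most
      \<open>2 * m\<close>.\<close>
    moreover have "i \<le> m" using diam[OF v] calculation by simp
    ultimately show "v \<in> (\<Union>i\<le>m. sphere u (2 * i))" using v by blast
  next
    fix v assume "v \<in> (\<Union>i\<le>m. sphere u (2 * i))"
    then have "v \<in> A \<union> B" "even (D u v)" by auto
    then show "v \<in> A" using D_parity[of u v] assms(1) by blast
  qed
  moreover have "card (\<Union>i\<le>m. sphere u (2 * i)) = (\<Sum>i\<le>m. card (sphere u (2 * i)))"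
    by (intro card_UN_disjoint ballI finite_sphere) auto
  ultimately show ?thesis by simp
qed

lemma card_A_le:
  assumes diam: "\<And>u v. \<lbrakk>u \<in> A; v \<in> A\<rbrakk> \<Longrightarrow> D u v \<le> 2 * m + 1"
  shows "card A \<le> (\<Sum>i\<le>m. sphere_bound a b (2 * i))"
proof (cases "A = {}")
  case False
  then obtain u where u: "u \<in> A" by blast
  have "card A = (\<Sum>i\<le>m. card (sphere u (2 * i)))"
    using card_A_eq_sum_spheres[OF u diam[OF u]] .
  also have "\<dots> \<le> (\<Sum>i\<le>m. sphere_bound a b (2 * i))"
    by (intro sum_mono card_sphere_le u)
  finally show ?thesis .
qed simp

text \<open>Tightness forces every even sphere up to radius \<open>2 * m\<close> to have full size,
  and a vertex with several parents would shrink its own sphere or the next one below the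
  bound.\<close>

lemma unique_parent_A:
  assumes diam: "\<And>u v. \<lbrakk>u \<in> A; v \<in> A\<rbrakk> \<Longrightarrow> D u v \<le> 2 * m + 1"
    and tight: "card A = (\<Sum>i\<le>m. sphere_bound a b (2 * i))"
    and "2 \<le> b"
    and u: "u \<in> A" and w: "w \<in> A \<union> B" "1 \<le> D u w" "D u w \<le> 2 * m"
  shows "card (parents E u w) = 1"
proof (rule ccontr)
  assume neq: "card (parents E u w) \<noteq> 1"
  have eq: "card (sphere u (2 * i)) = sphere_bound a b (2 * i)" if "i \<le> m" for i
  proof (rule ccontr)
    assume "card (sphere u (2 * i)) \<noteq> sphere_bound a b (2 * i)"
    then have "card (sphere u (2 * i)) < sphere_bound a b (2 * i)"
      using card_sphere_le[OF u, of "2 * i"] by simp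
    then have "(\<Sum>i\<le>m. card (sphere u (2 * i))) < (\<Sum>i\<le>m. sphere_bound a b (2 * i))"
      using that by (intro sum_strict_mono_ex1 ballI card_sphere_le u) auto
    then show False
      using card_A_eq_sum_spheres[OF u diam[OF u]] tight by simp
  qed
  obtain d where d: "D u w = Suc d" using w(2) by (cases "D u w") auto
  have less: "card (sphere u (Suc d)) < sphere_bound a b (Suc d)"
    using card_sphere_less[OF u _ neq] w(1) d by simp
  show False
  proof (cases "even d")
    case False
    then obtain i where i: "Suc d = 2 * i" by (metis evenE even_Suc)
    then have "i \<le> m" using d w(3) by simp
    from eq[OF this] less show False unfolding i by simp
  next
    \<comment> \<open>Odd spheres do not contribute to \<open>card A\<close>, but the deficit passes
      to the next sphere because \<open>b - 1\<close> is positive. Its radius is still at most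
      \<open>2 * m\<close>, as \<open>D u w\<close> is odd.\<close>
    case True
    then obtain i where i: "d = 2 * i" by (rule evenE)
    have "card (sphere u (Suc (Suc d))) \<le> (b - 1) * card (sphere u (Suc d))"
      using card_sphere_le_sum_parents[OF u, of "Suc d"] sum_card_parents_le[OF u, of d] True
      by simp
    also have "\<dots> < (b - 1) * sphere_bound a b (Suc d)"
      using less \<open>2 \<le> b\<close> by simp
    also have "\<dots> = sphere_bound a b (Suc (Suc d))"
      using True by simp
    finally have "card (sphere u (2 * Suc i)) < sphere_bound a b (2 * Suc i)"
      using i by (simp only: mult_Suc_right add_2_eq_Suc)
    moreover have "Suc i \<le> m" using d w(3) i by simp
    ultimately show False using eq[of "Suc i"] by simp
  qed
qed

lemma parents_eq:
  assumes "card (parents E u w) = 1" "v \<in> parents E u w" "v' \<in> parents E u w"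
  shows "v = v'"
  using assms by (metis card_1_singletonE singletonD)

text \<open>
  If \<open>w\<close> has two parents as seen from \<open>u \<in> B\<close>, then moving the centre to the neighbour \<open>p \<in> A\<close> of \<open>u\<close>
  on one of the two geodesics still leaves some vertex with two parents: \<open>w\<close> itself or \<open>w2\<close>.
\<close>

lemma unique_parent_B:
  assumes unique: "\<And>u w. \<lbrakk>u \<in> A; w \<in> A \<union> B; 1 \<le> D u w; D u w \<le> 2 * m\<rbrakk>
      \<Longrightarrow> card (parents E u w) = 1"
    and u: "u \<in> B" and w: "w \<in> A \<union> B" "1 \<le> D u w" "D u w \<le> 2 * m"
  shows "card (parents E u w) = 1"
proof (rule ccontr)
  assume neq: "card (parents E u w) \<noteq> 1"
  obtain d where d: "D u w = Suc d" using w(2) by (cases "D u w") auto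
  have "2 \<le> card (parents E u w)"
    using neq card_parents_ge_1[of u w d] u w(1) d by simp
  then obtain w1 w2 where w12: "w1 \<in> parents E u w" "w2 \<in> parents E u w" "w1 \<noteq> w2"
    by (metis card_le_Suc0_iff_eq finite_parents not_less_eq_eq numeral_2_eq_2)
  have V: "w1 \<in> A \<union> B" "w2 \<in> A \<union> B" "u \<in> A \<union> B"
    using w12 u edge_in by (auto simp: parents_def)
  have e: "(w1, w) \<in> E" "(w2, w) \<in> E" and D12: "D u w1 = d" "D u w2 = d"
    using w12 d by (auto simp: parents_def)
  have "d \<noteq> 0" using D12 D_eq_0 V w12(3) by metis
  then obtain k where k: "d = Suc k" by (cases d) auto
  \<comment> \<open>Take for \<open>p\<close> the last vertex before \<open>u\<close> on a geodesic
    from \<open>x\<close>. Since \<open>w\<close> is at distance \<open>k + 2\<close> from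
    \<open>u\<close>, it cannot be closer to \<open>p\<close> than \<open>k + 1\<close>.\<close>
  have nbr: "\<exists>p \<in> A. (p, u) \<in> E \<and> D x p = k \<and> D w p = Suc k"
    if x: "x \<in> A \<union> B" "(x, w) \<in> E" "D u x = d" for x
  proof -
    obtain p where p: "(p, u) \<in> E" "D x p = k"
      using parent_exists[OF x(1) V(3)] x(3) k D_sym by metis
    have "p \<in> A" using p(1) u edges disjoint by blast
    have "D p w \<le> Suc k" using D_edge_le[OF _ x(2), of p] \<open>p \<in> A\<close> p(2) D_sym by auto
    moreover have "D w u \<le> Suc (D w p)" using D_edge_le[OF w(1) p(1)] .
    ultimately have "D w p = Suc k" using D_sym d k by (metis Suc_le_mono le_antisym)
    with p \<open>p \<in> A\<close> show ?thesis by blast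
  qed
  obtain p where p: "p \<in> A" "(p, u) \<in> E" "D w1 p = k" "D w p = Suc k"
    using nbr[OF V(1) e(1) D12(1)] by blast
  \<comment> \<open>Otherwise \<open>w1\<close> and \<open>w2\<close> are two parents of
    \<open>w\<close> as seen from \<open>p\<close>, a centre in \<open>A\<close>.\<close>
  have two_parents: False if "D w2 p = k"
  proof -
    have "w1 \<in> parents E p w" "w2 \<in> parents E p w"
      using e p that D_sym by (auto simp: parents_def)
    moreover have "card (parents E p w) = 1"
      using unique[OF p(1) w(1)] p(4) d k w(3) D_sym[of p w] by simp
    ultimately show False using parents_eq w12(3) by blast
  qed
  show False
  proof (cases "w \<in> A")
    case True
    \<comment> \<open>Now \<open>w\<close> itself may serve as centre: the neighbours of
      \<open>u\<close> towards \<open>w1\<close> and \<open>w2\<close> are both parents of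
      \<open>u\<close>, hence they coincide.\<close>
    obtain q where q: "q \<in> A" "(q, u) \<in> E" "D w2 q = k" "D w q = Suc k"
      using nbr[OF V(2) e(2) D12(2)] by blast
    have "card (parents E w u) = 1"
      using unique[OF True V(3)] w(2,3) D_sym[of u w] by simp
    moreover have "p \<in> parents E w u" "q \<in> parents E w u"
      using p q d k D_sym[of u w] by (auto simp: parents_def)
    ultimately have "p = q" by (rule parents_eq)
    then show False using two_parents q(3) by blast
  next
    case False
    \<comment> \<open>As \<open>w2\<close> is not at distance \<open>k\<close> from
      \<open>p\<close>, it lies beyond \<open>w\<close>, at distance \<open>k + 2\<close>. Its
      parents seen from \<open>p\<close> then include \<open>w\<close> and the predecessor
      \<open>q\<close> of \<open>w2\<close> on a geodesic from \<open>u\<close>; they differ because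
      their distances from \<open>u\<close> are \<open>k + 2\<close> and \<open>k\<close>.\<close>
    have pV: "p \<in> A \<union> B" using p(1) by blast
    have "D p w2 = Suc (Suc k)"
      using D_edge[OF pV e(2)] p(4) two_parents D_sym[of p] by auto
    moreover obtain q where q: "(q, w2) \<in> E" "D u q = k"
      using parent_exists[OF V(3) V(2)] D12(2) k by metis
    have qV: "q \<in> A \<union> B" using q(1) edge_in by blast
    have "D p q \<le> Suc k"
      using D_edge_le[OF qV edge_sym[OF p(2)]] q(2) D_sym by metis
    ultimately have "D p q = Suc k"
      using D_edge[OF pV q(1)] by auto
    then have "q \<in> parents E p w2" "w \<in> parents E p w2"
      using q(1) edge_sym[OF e(2)] \<open>D p w2 = Suc (Suc k)\<close> p(4) D_sym[of p w]
      by (auto simp: parents_def)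
    moreover have "card (parents E p w2) = 1"
      using unique[OF p(1) V(2)] \<open>D p w2 = Suc (Suc k)\<close> w(3) d k by simp
    ultimately have "q = w" using parents_eq by blast
    then show False using q(2) d k by simp
  qed
qed

text \<open>Unique parents carry over from centres in \<open>A\<close> to centres in
  \<open>B\<close>, so the even spheres around a vertex of \<open>B\<close> have full size, and they
  exhaust \<open>B\<close>.\<close>

lemma card_B_if_tight:
  assumes diam: "\<And>u v. \<lbrakk>u \<in> A \<union> B; v \<in> A \<union> B\<rbrakk> \<Longrightarrow> D u v \<le> 2 * m + 1"
    and tight: "card A = (\<Sum>i\<le>m. sphere_bound a b (2 * i))"
    and "2 \<le> b" "B \<noteq> {}"
  shows "card B = (\<Sum>i\<le>m. sphere_bound b a (2 * i))"
proof -
  interpret swap: biregular_bipartite E B A b a by (rule swap)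
  obtain u where u: "u \<in> B" using \<open>B \<noteq> {}\<close> by blast
  have unique: "card (parents E u w) = 1"
    if "w \<in> B \<union> A" "1 \<le> D u w" "D u w \<le> 2 * m" for w
    using unique_parent_B[OF unique_parent_A[OF _ tight \<open>2 \<le> b\<close>] u] diam that by auto
  have "card (swap.sphere u (2 * i)) = sphere_bound b a (2 * i)" if "i \<le> m" for i
    using swap.card_sphere_eq[OF u unique, of "2 * m"] that by simp
  then show ?thesis
    using swap.card_A_eq_sum_spheres[OF u diam] u by simp
qed

lemma edge_count: "a * card A = b * card B"
proof -
  have "(\<Sum>v\<in>A. card {w \<in> B. (v, w) \<in> E}) = (\<Sum>w\<in>B. b)"
  proof (rule sum_multicount_gen[OF finite_A finite_B], rule ballI)
    fix w assume w: "w \<in> B"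
    then have "{v \<in> A. (v, w) \<in> E} = E `` {w}"
      using edges disjoint edge_sym by blast
    then show "card {v \<in> A. (v, w) \<in> E} = b" using degree_B[OF w] by simp
  qed
  moreover have "{w \<in> B. (v, w) \<in> E} = E `` {v}" if "v \<in> A" for v
    using that edges disjoint by blast
  ultimately show ?thesis using degree_A by (simp add: mult.commute)
qed

end


section \<open>From library digraphs to the relation \<open>arcs_ends G\<close>\<close>

lemma (in wf_digraph) awalk_relpow: "awalk u p v \<Longrightarrow> (u, v) \<in> arcs_ends G ^^ length p"
proof (induction p arbitrary: u)
  case Nil
  then show ?case by (simp add: awalk_Nil_iff)
next
  case (Cons e p)
  then have "(u, head G e) \<in> arcs_ends G" "(head G e, v) \<in> arcs_ends G ^^ length p"
    by (auto simp: awalk_Cons_iff arcs_ends_conv)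
  then show ?case by (simp add: relpow_commute[symmetric] relcomp.relcompI)
qed

lemma (in wf_digraph) relpow_if_graph_dist_le:
  assumes "graph_dist G u v \<le> ereal (real n)"
  obtains k where "k \<le> n" "(u, v) \<in> arcs_ends G ^^ k"
proof -
  \<comment> \<open>The distance is an infimum of walk costs; relaxing to a strict bound
    \<open>n + 1\<close> lets a walk be picked, and integrality of its length restores
    \<open>n\<close>.\<close>
  have "(INF p\<in>{p. awalk u p v}. ereal (awalk_cost (\<lambda>_. 1) p)) < ereal (real n + 1)"
    using assms unfolding graph_dist_def \<mu>_def
    by (rule order.strict_trans1) simp
  then obtain p where p: "awalk u p v" "awalk_cost (\<lambda>_. 1) p < real n + 1"
    by (auto simp: INF_less_iff)
  moreover have "awalk_cost (\<lambda>_. 1) p = real (length p)"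
    by (induction p) simp_all
  ultimately have "length p \<le> n" by simp
  with awalk_relpow[OF p(1)] show thesis by (rule that[rotated])
qed

lemma (in nomulti_digraph) card_out_neighbours: "card (arcs_ends G `` {v}) = out_degree G v"
proof -
  have "arcs_ends G `` {v} = head G ` out_arcs G v"
    by (auto simp: arcs_ends_conv)
  moreover have "inj_on (head G) (out_arcs G v)"
    by (rule inj_onI) (auto intro: no_multi_arcs simp: arc_to_ends_def)
  ultimately show ?thesis
    by (simp add: card_image out_degree_def)
qed

text \<open>A finite diameter excludes infinite distances, which supplies the connectedness required
  by the locale.\<close>

lemma rel_dist_le_graph_diameter:
  assumes "wf_digraph G" "graph_diameter G = ereal (real n)" "u \<in> verts G" "v \<in> verts G"
  shows "(u, v) \<in> (arcs_ends G)\<^sup>*" and "rel_dist (arcs_ends G) u v \<le> n"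
proof -
  have "graph_dist G u v \<le> graph_diameter G"
    unfolding graph_diameter_def by (rule SUP_upper2[of "(u, v)"]) (use assms in auto)
  then obtain k where k: "k \<le> n" "(u, v) \<in> arcs_ends G ^^ k"
    using wf_digraph.relpow_if_graph_dist_le assms(1,2) by metis
  show "(u, v) \<in> (arcs_ends G)\<^sup>*" using k(2) by (rule relpow_imp_rtrancl)
  show "rel_dist (arcs_ends G) u v \<le> n" using rel_dist_le[OF k(2)] k(1) by simp
qed

text \<open>\<open>V2\<close> takes the role of \<open>A\<close>, because \<open>N2'\<close> bounds
  the class of degree \<open>s\<close>.\<close>

lemma biregular_bipartite_if_graph:
  assumes "bipartite_biregular G V1 V2 r s" "graph_diameter G = ereal (real n)"
  shows "biregular_bipartite (arcs_ends G) V2 V1 s r"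
proof -
  interpret graph G using assms(1) by (simp add: bipartite_biregular_def)
  have V: "verts G = V1 \<union> V2" "V1 \<inter> V2 = {}"
    using assms(1) by (simp_all add: bipartite_biregular_def)
  show ?thesis
  proof
    show "finite V2" "finite V1" using finite_verts V(1) by auto
    show "V2 \<inter> V1 = {}" using V(2) by blast
    show "sym (arcs_ends G)" using sym_arcs by (simp add: symmetric_def)
    show "arcs_ends G \<subseteq> V2 \<times> V1 \<union> V1 \<times> V2"
    proof (rule subrelI)
      fix u v assume uv: "(u, v) \<in> arcs_ends G"
      then have "u \<in> V1 \<union> V2" "v \<in> V1 \<union> V2"
        using adj_in_verts[OF uv] V(1) by auto
      then show "(u, v) \<in> V2 \<times> V1 \<union> V1 \<times> V2"
        using uv assms(1) unfolding bipartite_biregular_def by blast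
    qed
    show "card (arcs_ends G `` {v}) = s" if "v \<in> V2" for v
      using that assms(1) by (simp add: card_out_neighbours bipartite_biregular_def)
    show "card (arcs_ends G `` {v}) = r" if "v \<in> V1" for v
      using that assms(1) by (simp add: card_out_neighbours bipartite_biregular_def)
    show "(u, v) \<in> (arcs_ends G)\<^sup>*" if "u \<in> V2 \<union> V1" "v \<in> V2 \<union> V1" for u v
      using rel_dist_le_graph_diameter(1)[OF wf_digraph assms(2)] that V(1) by blast
  qed
qed

section \<open>Arithmetic of the bound and the conclusion\<close>

lemma geom_quot_eq_sum:
  assumes "1 \<le> r" "1 \<le> s" "(r - 1) * (s - 1) \<noteq> 1"
  shows "geom_quot r s m = int (\<Sum>i<m. ((r - 1) * (s - 1)) ^ i)"
proof -
  have x: "(int r - 1) * (int s - 1) = int ((r - 1) * (s - 1))"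
    using assms by (simp add: of_nat_diff)
  \<comment> \<open>A zero divisor would make \<open>div\<close> return 0 instead of the
    sum.\<close>
  have "int ((r - 1) * (s - 1)) - 1 \<noteq> 0" using assms(3) by linarith
  then show ?thesis
    unfolding geom_quot_def x power_diff_1_eq by simp
qed

lemma card_V2_less_N2':
  assumes G: "bipartite_biregular G V1 V2 r s" "graph_diameter G = ereal (real (2 * m + 1))"
    and "s < r" "2 \<le> s" "1 \<le> m"
  shows "int (card V2) < N2' r s m"
proof -
  interpret biregular_bipartite "arcs_ends G" V2 V1 s r
    using biregular_bipartite_if_graph[OF G] .
  have "wf_digraph G" "verts G = V1 \<union> V2"
    using G(1) by (auto simp: bipartite_biregular_def graph_def digraph_def fin_digraph_def)
  then have diam: "D u v \<le> 2 * m + 1" if "u \<in> V2 \<union> V1" "v \<in> V2 \<union> V1" for u v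
    using rel_dist_le_graph_diameter(2)[OF _ G(2)] that by blast
  define x where "x = (r - 1) * (s - 1)"
  define g where "g = (\<Sum>i<m. x ^ i)"
  have "2 * 1 \<le> x" unfolding x_def using assms by (intro mult_le_mono) auto
  then have x2: "2 \<le> x" by simp
  have g: "geom_quot r s m = int g"
    unfolding g_def x_def using geom_quot_eq_sum x2 assms x_def by simp
  have "1 \<le> g" unfolding g_def using member_le_sum[of 0 "{..<m}" "\<lambda>i. x ^ i"] \<open>1 \<le> m\<close> by simp
  have bound2: "(\<Sum>i\<le>m. sphere_bound s r (2 * i)) = 1 + s * (r - 1) * g"
    unfolding sum_even_sphere_bound g_def x_def by (simp add: mult.commute)
  have bound1: "(\<Sum>i\<le>m. sphere_bound r s (2 * i)) = 1 + r * (s - 1) * g"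
    unfolding sum_even_sphere_bound g_def x_def by simp
  have N2': "N2' r s m = int (1 + s * (r - 1) * g)"
    using assms g by (simp add: N2'_def of_nat_diff)
  have "card V2 \<le> 1 + s * (r - 1) * g"
    using card_A_le[of m] diam bound2 by simp
  moreover have "card V2 \<noteq> 1 + s * (r - 1) * g"
  proof
    assume tight: "card V2 = 1 + s * (r - 1) * g"
    \<comment> \<open>Otherwise the edge count would give \<open>s * card V2 = 0\<close>.\<close>
    then have "V1 \<noteq> {}" using edge_count assms by auto
    then have "card V1 = 1 + r * (s - 1) * g"
      using card_B_if_tight[OF diam] tight bound1 bound2 assms by simp
    then have "s * (1 + s * (r - 1) * g) = r * (1 + r * (s - 1) * g)"
      using edge_count tight by simp
    then have "int (s * (1 + s * (r - 1) * g)) = int (r * (1 + r * (s - 1) * g))"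
      by (rule arg_cong)
    then have "int s * (1 + int s * (int r - 1) * int g) = int r * (1 + int r * (int s - 1) * int g)"
      using assms(3,4) by (simp add: of_nat_diff distrib_left)
    \<comment> \<open>This factorisation rests on r^2 (s - 1) - s^2 (r - 1) = (r - s) ((r - 1) (s -
      1) - 1).\<close>
    then have "(int r - int s) * (1 + int g * ((int r - 1) * (int s - 1) - 1)) = 0"
      by (simp add: algebra_simps)
    moreover have "(int r - 1) * (int s - 1) = int x"
      using assms by (simp add: x_def of_nat_diff)
    ultimately have "1 + int g * (int x - 1) = 0" using \<open>s < r\<close> by simp
    moreover have "0 \<le> int g * (int x - 1)" using x2 by simp
    ultimately show False by simp
  qed
  ultimately show ?thesis unfolding N2' by linarith
qed

lemma rho_dvd_N2':
  assumes "int (rho r s) dvd int s * geom_quot r s m - 1"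
  shows "int (rho r s) dvd N2' r s m"
proof -
  \<comment> \<open>Written this way, \<open>N2'\<close> is a multiple of the term in the hypothesis
    plus \<open>r\<close>, and \<open>rho r s\<close> divides both.\<close>
  have "N2' r s m = (int r - 1) * (int s * geom_quot r s m - 1) + int r"
    by (simp add: N2'_def algebra_simps)
  moreover have "int (rho r s) dvd int r"
    unfolding rho_def int_dvd_int_iff by (metis dvd_triv_right dvd_mult_div_cancel gcd_dvd1)
  ultimately show ?thesis using assms by simp
qed

text \<open>After division by the gcd the two factors are coprime, so a single multiplier
  \<open>k\<close> determines both class sizes.\<close>

lemma biregular_card_classes:
  assumes "0 < r" "s * c2 = r * c1"
  obtains k where "c1 = k * sigma r s" "c2 = k * rho r s"
proof -
  define h where "h = gcd r s"
  have h: "0 < h" "r = rho r s * h" "s = sigma r s * h"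
    using assms(1) by (auto simp: h_def rho_def sigma_def)
  have eq: "sigma r s * c2 = rho r s * c1"
    using assms(2) h by (metis mult.assoc mult.commute mult_left_cancel neq0_conv)
  have "coprime (rho r s) (sigma r s)"
    unfolding rho_def sigma_def using assms(1) by (intro div_gcd_coprime) auto
  moreover have "rho r s dvd sigma r s * c2" using eq by simp
  ultimately obtain k where k: "c2 = rho r s * k"
    by (auto simp: coprime_dvd_mult_right_iff)
  have "0 < rho r s" using h assms(1) by (metis mult_is_0 neq0_conv)
  then have "c1 = k * sigma r s" using eq k by (simp add: ac_simps)
  then show thesis using k that[of k] by (simp add: mult.commute)
qed

theorem theorem2p5:
  fixes r s m :: nat
  assumes "s < r" and "2 \<le> s" and "1 \<le> m"
    and "int (rho r s) dvd int s * geom_quot r s m - 1"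
  shows "(\<nexists>(G :: ('a, 'b) pre_digraph) V1 V2.
            bipartite_biregular G V1 V2 r s \<and>
            graph_diameter G = ereal (real (2 * m + 1)) \<and>
            int (card (verts G)) = moore_bound r s m) \<and>
         (\<forall>(G :: ('a, 'b) pre_digraph) V1 V2.
            bipartite_biregular G V1 V2 r s \<and>
            graph_diameter G = ereal (real (2 * m + 1)) \<longrightarrow>
              real (card V1) \<le> (real_of_int (N2' r s m) / real (rho r s) - 1) * real (sigma r s) \<and>
              real (card V2) \<le> (real_of_int (N2' r s m) / real (rho r s) - 1) * real (rho r s) \<and>
              real (card (verts G)) \<le> improved_bound r s m)"
proof -
  have rho_pos: "0 < rho r s"
    using assms(1) by (simp add: rho_def div_greater_zero_iff gcd_le1_nat)
  obtain q where q: "N2' r s m = int (rho r s) * q"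
    using rho_dvd_N2'[OF assms(4)] by (auto elim: dvdE)
  have quot: "real_of_int (N2' r s m) / real (rho r s) = real_of_int q"
    using q rho_pos by simp
  have bounds: "real (card V1) \<le> (real_of_int q - 1) * real (sigma r s) \<and>
      real (card V2) \<le> (real_of_int q - 1) * real (rho r s) \<and>
      real (card (verts G)) \<le> (real_of_int q - 1) * (real (rho r s) + real (sigma r s))"
    if G: "bipartite_biregular G V1 V2 r s" "graph_diameter G = ereal (real (2 * m + 1))"
    for G :: "('a, 'b) pre_digraph" and V1 V2
  proof -
    interpret biregular_bipartite "arcs_ends G" V2 V1 s r
      using biregular_bipartite_if_graph[OF G] .
    obtain k where k: "card V1 = k * sigma r s" "card V2 = k * rho r s"
      using biregular_card_classes[OF _ edge_count] assms(1) by auto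
    have "int k * int (rho r s) < q * int (rho r s)"
      using card_V2_less_N2'[OF G assms(1-3)] k(2) q by (simp add: mult.commute)
    then have "int k < q" using rho_pos by simp
    \<comment> \<open>Integrality turns the strict inequality into the gain of one in the
      multiplier.\<close>
    then have "real k \<le> real_of_int q - 1" by linarith
    then have "real (card V1) \<le> (real_of_int q - 1) * real (sigma r s)"
      "real (card V2) \<le> (real_of_int q - 1) * real (rho r s)"
      unfolding k by (simp_all add: mult_right_mono)
    moreover have "card (verts G) = card V1 + card V2"
      using G(1) finite_A finite_B disjoint
      by (simp add: bipartite_biregular_def card_Un_disjoint)
    ultimately show ?thesis by (simp add: distrib_left)
  qed
  \<comment> \<open>The quotient is an integer, so the floor is \<open>q\<close> itself and
    \<open>moore_bound\<close> exceeds the order bound just proved by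
    \<open>rho r s + sigma r s\<close>, which excludes equality.\<close>
  have "moore_bound r s m = q * (int (rho r s) + int (sigma r s))"
    unfolding moore_bound_def quot by simp
  then have "real_of_int (moore_bound r s m) > (real_of_int q - 1) * (real (rho r s) + real (sigma r s))"
    using rho_pos by (simp add: algebra_simps)
  then show ?thesis
    using bounds unfolding improved_bound_def quot by (metis linorder_not_le of_int_of_nat_eq)
qed

end
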